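(* Let $n,s,t,\delta$ be integers with $s\ge 2$ and $2\le t\le \delta\le \left\lfloor \frac{n+t-3}{2}\right\rfloor$, and let $h=\left\lfloor \frac{n+t-3}{2}\right\rfloor$. Put $$f_2(n,t,\delta,s)=\binom{n+t-\delta-2}{s}+(\delta-t+2)\binom{\delta}{s-1},$$ $$g_2(n,t,\delta,s)=\binom{n+t-h-2}{s}+(h-t+1)\binom{h}{s-1}+\binom{\delta}{s-1}.$$ Let $G$ be a finite, simple, connected graph of order $n$ with minimum degree $\delta$. If $$N_s(G)>\max\{f_2(n,t,\delta,s),\,g_2(n,t,\delta,s)\},$$ then $G$ is one-to-one $t$-disjoint path coverable.
   Context: The order of a graph is its number of vertices. $N_s(G)$ is the number of $s$-cliques of $G$, i.e. of sets of exactly $s$ vertices of $G$ that are pairwise adjacent. A graph $G$ is one-to-one $t$-disjoint path coverable if for any two distinct vertices $u,v$ of $G$ there exist $t$ distinct paths in $G$, each joining $u$ and $v$, such that every vertex of $G$ lies on at least one of the paths and any two of the paths have no common vertices other than $u$ and $v$. Binomial coefficients $\binom{a}{b}$ with integers $0\le a<b$ are $0$. *)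

theory Defs
  imports "Graph_Theory.Graph_Theory"
begin

text \<open>
  Finite simple graphs are the \<^locale>\<open>pair_graph\<close>s of the AFP entry Graph\_Theory: an undirected
  edge is represented by its two arcs \<open>(u, v)\<close> and \<open>(v, u)\<close>, and there are no loops.
\<close>

definition cliques :: "nat \<Rightarrow> 'a pair_pre_digraph \<Rightarrow> 'a set set" where
  "cliques s G = {S. S \<subseteq> pverts G \<and> card S = s \<and>
     (\<forall>u\<in>S. \<forall>v\<in>S. u \<noteq> v \<longrightarrow> (u, v) \<in> parcs G)}"

definition num_cliques :: "nat \<Rightarrow> 'a pair_pre_digraph \<Rightarrow> nat" where
  "num_cliques s G = card (cliques s G)"

text \<open>
  In a symmetric digraph without parallel arcs, the out-degree of a vertex is its number of
  neighbours. The minimum is meaningful for finite graphs with at least one vertex.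
\<close>

definition min_degree :: "'a pair_pre_digraph \<Rightarrow> nat" where
  "min_degree G = Min (out_degree (with_proj G) ` pverts G)"

text \<open>
  A path from \<open>u\<close> to \<open>v\<close> is a list of consecutive arcs that visits no vertex twice. For \<open>u \<noteq> v\<close>,
  fixing the direction from \<open>u\<close> to \<open>v\<close> makes distinct lists the same as distinct undirected paths.
\<close>

definition one_to_one_disjoint_path_coverable :: "nat \<Rightarrow> 'a pair_pre_digraph \<Rightarrow> bool" where
  "one_to_one_disjoint_path_coverable t G \<longleftrightarrow>
     (\<forall>u\<in>pverts G. \<forall>v\<in>pverts G. u \<noteq> v \<longrightarrow>
        (\<exists>P. finite P \<and> card P = t \<and>
             (\<forall>p\<in>P. pre_digraph.apath (with_proj G) u p v) \<and>
             (\<forall>w\<in>pverts G. \<exists>p\<in>P. w \<in> set (pawalk_verts u p)) \<and>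
             (\<forall>p\<in>P. \<forall>q\<in>P. p \<noteq> q \<longrightarrow>
                set (pawalk_verts u p) \<inter> set (pawalk_verts u q) \<subseteq> {u, v})))"

text \<open>
  All subtractions below are exact (no truncation) when
  \<open>s \<ge> 2\<close> and \<open>2 \<le> t \<le> \<delta> \<le> (n + t - 3) div 2\<close>.
\<close>

definition f2 :: "nat \<Rightarrow> nat \<Rightarrow> nat \<Rightarrow> nat \<Rightarrow> nat" where
  "f2 n t \<delta> s = ((n + t - \<delta> - 2) choose s) + (\<delta> - t + 2) * (\<delta> choose (s - 1))"

definition g2 :: "nat \<Rightarrow> nat \<Rightarrow> nat \<Rightarrow> nat \<Rightarrow> nat" where
  "g2 n t \<delta> s =
     (let h = (n + t - 3) div 2 in
        ((n + t - h - 2) choose s) + (h - t + 1) * (h choose (s - 1)) + (\<delta> choose (s - 1)))"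

end

theory Submission
  imports Defs
begin

text \<open>
  Call a set of \<open>t\<close> internally disjoint paths from \<open>u\<close> to \<open>v\<close> through all vertices a cover. A
  crossing argument in the manner of Bondy and Chvatal shows: if adding the edge \<open>xy\<close> creates a
  cover, and there was none before, then \<open>d(x) + d(y) \<le> n + t - 3\<close>, because the cover has
  \<open>n + t - 3\<close> edges besides \<open>xy\<close> and none of them can be exchanged.

  Suppose that \<open>G\<close> has no cover for \<open>u, v\<close>, and let \<open>H\<close> be an edge-maximal supergraph without one.
  Among the non-adjacent pairs of \<open>H\<close> take \<open>x, y\<close> with largest degree sum and
  \<open>k = d(x) \<le> d(y)\<close>. The at least \<open>k - t + 2\<close> vertices not adjacent to \<open>y\<close> all have degree at
  most \<open>k\<close>, where \<open>\<delta> \<le> k \<le> h\<close>. Replacing one of them by a vertex of degree \<open>\<delta>\<close> in \<open>G\<close> gives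
  \<open>N\<^sub>s(G) \<le> C(n + t - k - 2, s) + (k - t + 1) C(k, s - 1) + C(\<delta>, s - 1)\<close>.
  The right-hand side is convex in \<open>k\<close>, and at \<open>k = \<delta>\<close> and \<open>k = h\<close> it equals \<open>f\<^sub>2\<close> and \<open>g\<^sub>2\<close>.
\<close>

section \<open>Path covers and edge exchange\<close>

text \<open>Vertex lists turn reversing, cutting and gluing of paths into plain list operations.
  \<open>walk_of_path_between\<close> translates them to arc lists at the end.\<close>

definition path_between :: "'a rel \<Rightarrow> 'a \<Rightarrow> 'a list \<Rightarrow> 'a \<Rightarrow> bool" where
  "path_between R u p v \<longleftrightarrow>
     p \<noteq> [] \<and> hd p = u \<and> last p = v \<and> distinct p \<and> successively (\<lambda>a b. (a, b) \<in> R) p"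

definition disjoint_path_cover ::
  "'a rel \<Rightarrow> 'a set \<Rightarrow> nat \<Rightarrow> 'a \<Rightarrow> 'a \<Rightarrow> 'a list set \<Rightarrow> bool" where
  "disjoint_path_cover R V t u v P \<longleftrightarrow>
     finite P \<and> card P = t \<and> (\<forall>p\<in>P. path_between R u p v) \<and> (\<Union>p\<in>P. set p) = V \<and>
     (\<forall>p\<in>P. \<forall>q\<in>P. p \<noteq> q \<longrightarrow> set p \<inter> set q \<subseteq> {u, v})"

lemma path_between_append:
  assumes "path_between R u p a" "path_between R b q v" "(a, b) \<in> R" "set p \<inter> set q = {}"
  shows "path_between R u (p @ q) v"
  using assms by (auto simp: path_between_def successively_append_iff)

lemma path_between_rev:
  assumes "sym R" "path_between R u p v"
  shows "path_between R v (rev p) u"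
  using assms by (auto simp: path_between_def hd_rev last_rev sym_def elim: successively_mono)

lemma path_between_split:
  assumes "path_between R u (p @ q) v" "p \<noteq> []" "q \<noteq> []"
  shows "path_between R u p (last p)" "path_between R (hd q) q v" "set p \<inter> set q = {}"
  using assms by (auto simp: path_between_def successively_append_iff)

lemma path_between_ends:
  assumes "path_between R u p v"
  shows "u \<in> set p" "v \<in> set p"
  using assms by (auto simp: path_between_def)

lemma path_between_length:
  assumes "path_between R u p v" "u \<noteq> v"
  shows "2 \<le> length p"
proof (cases p)
  case Nil
  then show ?thesis using assms by (auto simp: path_between_def)
next
  case (Cons a p')
  then show ?thesis using assms by (cases p') (auto simp: path_between_def)
qed

text \<open>When paths that may share only \<open>u\<close> and \<open>v\<close> are exchanged, two
  of them can coincide only as \<open>[u, v]\<close>. This is the degenerate case to watch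
  below.\<close>

lemma path_between_doubleton:
  assumes "path_between R u p v" "u \<noteq> v" "set p \<subseteq> {u, v}"
  shows "p = [u, v]"
proof -
  have "card (set p) \<le> card {u, v}" using assms by (intro card_mono) auto
  then have "length p \<le> 2" using assms by (auto simp: path_between_def distinct_card)
  then have "length p = 2" using path_between_length[OF assms(1,2)] by simp
  then obtain c d where "p = [c, d]" by (auto simp: length_Suc_conv eval_nat_numeral)
  then show ?thesis using assms by (auto simp: path_between_def)
qed

text \<open>Since \<open>v\<close> lies on the part from \<open>y\<close> on, distinctness leaves
  only \<open>x = u\<close> and then \<open>y = v\<close>; nothing precedes the first vertex or
  follows the last.\<close>

lemma path_between_edge_ends:
  assumes "path_between R u (c @ x # y # d) v" "{x, y} \<subseteq> {u, v}"
  shows "x = u \<and> y = v \<and> c = [] \<and> d = []"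
proof -
  have dist: "distinct (c @ x # y # d)" and h: "hd (c @ x # y # d) = u"
    and l: "last (y # d) = v"
    using assms by (auto simp: path_between_def)
  have "v \<in> set (y # d)" using l last_in_set by blast
  then have "x = u" using dist assms(2) by auto
  moreover have "y = v" using dist assms(2) calculation by auto
  moreover have "c = []" using h dist \<open>x = u\<close> by (cases c) auto
  moreover have "d = []" using l dist \<open>y = v\<close> by (cases d) (auto split: if_splits)
  ultimately show ?thesis by simp
qed

lemma path_between_drop_edge:
  assumes "path_between (insert (x, y) (insert (y, x) R)) u p v" "\<not> {x, y} \<subseteq> set p"
  shows "path_between R u p v"
  using assms by (auto simp: path_between_def elim!: successively_mono)

text \<open>A path other than \<open>[u, v]\<close> has a nonempty interior \<open>m\<close>. Its
  pieces \<open>u # m\<close> and \<open>m @ [v]\<close> contain all its edges, and each misses one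
  end of the edge \<open>uv\<close>.\<close>

lemma path_between_drop_end_edge:
  assumes "path_between (insert (u, v) (insert (v, u) R)) u p v" "u \<noteq> v" "p \<noteq> [u, v]"
  shows "path_between R u p v"
proof -
  let ?R = "insert (u, v) (insert (v, u) R)"
  obtain m where p: "p = u # m @ [v]"
  proof -
    obtain p' where "p = u # p'" using assms(1) by (cases p) (auto simp: path_between_def)
    moreover from this have "p' \<noteq> []" "last p' = v"
      using assms(1,2) by (auto simp: path_between_def split: if_splits)
    ultimately show ?thesis using that[of "butlast p'"] append_butlast_last_id[of p'] by simp
  qed
  then have m: "m \<noteq> []" using assms(3) by auto
  have 1: "path_between ?R u (u # m) (last m)"
    using path_between_split(1)[of ?R u "u # m" "[v]" v] assms(1) p m by simp
  have 2: "path_between ?R (hd m) (m @ [v]) v"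
    using path_between_split(2)[of ?R u "[u]" "m @ [v]" v] assms(1) p m by simp
  have d: "distinct (u # m @ [v])" using assms(1) p by (simp add: path_between_def)
  have "path_between R u (u # m) (last m)" "path_between R (hd m) (m @ [v]) v"
    using d by (auto intro!: path_between_drop_edge[OF 1] path_between_drop_edge[OF 2])
  then show ?thesis using p d m
    by (auto simp: path_between_def successively_append_iff successively_Cons)
qed

text \<open>Exchanges the paths \<open>Q\<close> for \<open>Q'\<close> on the same vertices while
  passing to the edge set \<open>E\<close>. The number \<open>t\<close> survives because a path
  common to \<open>P - Q\<close> and \<open>Q'\<close> would have to be \<open>[u, v]\<close>, which
  \<open>edge\<close> rules out.\<close>

lemma disjoint_path_cover_replace:
  assumes cover: "disjoint_path_cover R V t u v P" and "u \<noteq> v"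
    and old: "\<And>p. p \<in> P - Q \<Longrightarrow> path_between E u p v"
    and new: "\<And>p. p \<in> Q' \<Longrightarrow> path_between E u p v"
    and "Q \<subseteq> P" "finite Q'" "card Q' = card Q" "(\<Union>p\<in>Q'. set p) = (\<Union>p\<in>Q. set p)"
    and disj: "\<And>p q. p \<in> Q' \<Longrightarrow> q \<in> Q' \<Longrightarrow> p \<noteq> q \<Longrightarrow> set p \<inter> set q \<subseteq> {u, v}"
    and edge: "[u, v] \<notin> (P - Q) \<inter> Q'"
  shows "disjoint_path_cover E V t u v ((P - Q) \<union> Q')"
proof -
  have P: "finite P" "card P = t" "(\<Union>p\<in>P. set p) = V"
    and Pd: "\<And>p q. p \<in> P \<Longrightarrow> q \<in> P \<Longrightarrow> p \<noteq> q \<Longrightarrow> set p \<inter> set q \<subseteq> {u, v}"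
    using cover unfolding disjoint_path_cover_def by blast+
  have mixed: "set p \<inter> set q \<subseteq> {u, v}" if "p \<in> P - Q" "q \<in> Q'" for p q
  proof
    fix w assume w: "w \<in> set p \<inter> set q"
    then have "w \<in> (\<Union>p\<in>Q. set p)" using assms(8) that by blast
    then obtain q' where "q' \<in> Q" "w \<in> set q'" by blast
    then show "w \<in> {u, v}" using Pd[of p q'] that w assms(5) by blast
  qed
  have "(P - Q) \<inter> Q' = {}"
  proof (rule ccontr)
    assume "\<not> ?thesis"
    then obtain r where r: "r \<in> P - Q" "r \<in> Q'" by blast
    then have "r = [u, v]"
      using mixed[OF r] path_between_doubleton[OF new[OF r(2)] assms(2)] by simp
    then show False using edge r by blast
  qed
  then have "card ((P - Q) \<union> Q') = card (P - Q) + card Q'"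
    using P assms(6) by (simp add: card_Un_disjoint)
  also have "\<dots> = t"
    using P assms(5,7) card_mono[OF P(1) assms(5)]
    by (simp add: card_Diff_subset finite_subset)
  finally have c: "card ((P - Q) \<union> Q') = t" .
  have "(\<Union>p\<in>(P - Q) \<union> Q'. set p) = V"
    using P(3) assms(5,8) by blast
  moreover have "set p \<inter> set q \<subseteq> {u, v}" if "p \<in> (P - Q) \<union> Q'" "q \<in> (P - Q) \<union> Q'" "p \<noteq> q" for p q
    using that mixed[of p q] mixed[of q p] disj[of p q] Pd[of p q] by blast
  moreover have "finite ((P - Q) \<union> Q')" using P(1) assms(6) by simp
  moreover have "\<forall>p\<in>(P - Q) \<union> Q'. path_between E u p v" using old new by blast
  ultimately show ?thesis
    using c unfolding disjoint_path_cover_def by blast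
qed

section \<open>Edges along a path and the crossing argument\<close>

definition steps :: "'a list \<Rightarrow> ('a \<times> 'a) set" where
  "steps p = set (zip p (tl p))"

lemma steps_iff: "(a, b) \<in> steps p \<longleftrightarrow> (\<exists>c d. p = c @ a # b # d)"
proof
  assume "(a, b) \<in> steps p"
  then show "\<exists>c d. p = c @ a # b # d"
  proof (induction p rule: induct_list012)
    case (3 x y zs)
    then consider "a = x" "b = y" | "(a, b) \<in> steps (y # zs)" by (auto simp: steps_def)
    then show ?case
    proof cases
      case 1
      then show ?thesis by (intro exI[of _ "[]"] exI[of _ zs]) simp
    next
      case 2
      then obtain c d where "y # zs = c @ a # b # d" using 3 by blast
      then show ?thesis by (intro exI[of _ "x # c"] exI[of _ d]) simp
    qed
  qed (auto simp: steps_def)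
next
  assume "\<exists>c d. p = c @ a # b # d"
  then obtain c d where p: "p = c @ a # b # d" by blast
  show "(a, b) \<in> steps p" unfolding p
  proof (induction c)
    case (Cons e c)
    then show ?case by (cases c) (auto simp: steps_def)
  qed (simp add: steps_def)
qed

lemma card_steps: "card (steps p) \<le> length p - 1"
  unfolding steps_def by (rule order_trans[OF card_length]) simp

lemma finite_steps [simp]: "finite (steps p)"
  by (simp add: steps_def)

lemma steps_successor:
  assumes "w \<in> set p" "w \<noteq> last p"
  obtains w' where "(w, w') \<in> steps p"
proof -
  obtain c d where p: "p = c @ w # d" using assms(1) by (auto simp: in_set_conv_decomp)
  then have "d \<noteq> []" using assms(2) by auto
  then obtain w' d' where "d = w' # d'" by (cases d) auto
  then show ?thesis using that p steps_iff by fast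
qed

lemma steps_predecessor:
  assumes "w \<in> set p" "w \<noteq> hd p"
  obtains w' where "(w', w) \<in> steps p"
proof -
  obtain c d where p: "p = c @ w # d" using assms(1) by (auto simp: in_set_conv_decomp)
  then have "c \<noteq> []" using assms(2) by auto
  then have "c = butlast c @ [last c]" by simp
  then have "p = butlast c @ last c # w # d" using p by (metis append.assoc append_Cons append_Nil)
  then show ?thesis using that steps_iff by fast
qed

text \<open>The cover \<open>P\<close> depends on the added edge \<open>xy\<close>, and
  \<open>a @ x # y # b\<close> is a path of it that runs through this edge from \<open>x\<close> to
  \<open>y\<close>. Traversal from \<open>y\<close> to \<open>x\<close> is the same setting with the
  two vertices exchanged.\<close>

locale broken_cover =
  fixes E :: "'a rel" and V :: "'a set" and t :: nat and u v x y :: 'a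
    and P :: "'a list set" and a b :: "'a list"
  assumes finite_V: "finite V" and edges_in: "E \<subseteq> V \<times> V" and sym_E: "sym E" and irrefl_E: "irrefl E"
    and uv: "u \<noteq> v" and xy: "x \<noteq> y" and nonedge: "(x, y) \<notin> E" and t: "2 \<le> t"
    and cover: "disjoint_path_cover (insert (x, y) (insert (y, x) E)) V t u v P"
    and broken: "a @ x # y # b \<in> P"
    and no_cover: "\<And>Q. \<not> disjoint_path_cover E V t u v Q"
begin

abbreviation "p0 \<equiv> a @ x # y # b"

lemma nonedge': "(y, x) \<notin> E"
  using nonedge sym_E by (auto simp: sym_def)

lemma finite_P: "finite P" and card_P: "card P = t" and cover_V: "(\<Union>p\<in>P. set p) = V"
  and path_P: "p \<in> P \<Longrightarrow> path_between (insert (x, y) (insert (y, x) E)) u p v"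
  and disjoint_P: "p \<in> P \<Longrightarrow> q \<in> P \<Longrightarrow> p \<noteq> q \<Longrightarrow> set p \<inter> set q \<subseteq> {u, v}"
  using cover unfolding disjoint_path_cover_def by blast+

lemma distinct_p0: "distinct p0"
  using path_P[OF broken] by (simp add: path_between_def)

lemma path_left: "path_between E u (a @ [x]) x"
proof (rule path_between_drop_edge)
  show "path_between (insert (x, y) (insert (y, x) E)) u (a @ [x]) x"
    using path_between_split(1)[of _ u "a @ [x]" "y # b" v] path_P[OF broken] by simp
  show "\<not> {x, y} \<subseteq> set (a @ [x])" using distinct_p0 by auto
qed

lemma path_right: "path_between E y (y # b) v"
proof (rule path_between_drop_edge)
  show "path_between (insert (x, y) (insert (y, x) E)) y (y # b) v"
    using path_between_split(2)[of _ u "a @ [x]" "y # b" v] path_P[OF broken] by simp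
  show "\<not> {x, y} \<subseteq> set (y # b)" using distinct_p0 by auto
qed

text \<open>Another path meets \<open>p0\<close> only in \<open>u\<close> and \<open>v\<close>. If
  it contains both \<open>x\<close> and \<open>y\<close>, then \<open>p0\<close> is
  \<open>[u, v]\<close> itself, and a different path cannot use the edge \<open>uv\<close>.\<close>

lemma path_other:
  assumes "p \<in> P" "p \<noteq> p0"
  shows "path_between E u p v"
proof (cases "{x, y} \<subseteq> set p")
  case False
  then show ?thesis using path_between_drop_edge path_P[OF assms(1)] by metis
next
  case True
  then have "{x, y} \<subseteq> {u, v}" using disjoint_P[OF assms(1) broken assms(2)] by auto
  then have *: "x = u \<and> y = v \<and> a = [] \<and> b = []"
    by (rule path_between_edge_ends[OF path_P[OF broken]])
  have "path_between (insert (u, v) (insert (v, u) E)) u p v" "p \<noteq> [u, v]"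
    using path_P[OF assms(1)] assms(2) * by auto
  from path_between_drop_end_edge[OF this(1) uv this(2)] show ?thesis .
qed

lemma replace_one:
  assumes "path_between E u p v" "set p = set p0" "p \<noteq> [u, v]"
  shows False
proof -
  have "disjoint_path_cover E V t u v ((P - {p0}) \<union> {p})"
    by (rule disjoint_path_cover_replace[OF cover uv])
      (use assms path_other broken in auto)
  then show False using no_cover by blast
qed

text \<open>The last assumption prevents a path \<open>[u, v]\<close> that stays in the cover from
  being produced a second time, which would lower the number of paths.\<close>

lemma replace_two:
  assumes "q \<in> P" "q \<noteq> p0" "path_between E u p' v" "path_between E u q' v"
    and "set p' \<union> set q' = set p0 \<union> set q" "set p' \<inter> set q' \<subseteq> {u, v}" "p' \<noteq> q'"
    and "[u, v] \<in> P \<Longrightarrow> q \<noteq> [u, v] \<Longrightarrow> p' \<noteq> [u, v] \<and> q' \<noteq> [u, v]"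
  shows False
proof -
  have "disjoint_path_cover E V t u v ((P - {p0, q}) \<union> {p', q'})"
  proof (rule disjoint_path_cover_replace[OF cover uv])
    show "path_between E u p v" if "p \<in> P - {p0, q}" for p
      using that path_other by blast
    show "path_between E u p v" if "p \<in> {p', q'}" for p
      using that assms(3,4) by blast
    show "{p0, q} \<subseteq> P" using assms(1) broken by blast
    show "card {p', q'} = card {p0, q}" using assms(2,7) by simp
    show "(\<Union>p\<in>{p', q'}. set p) = (\<Union>p\<in>{p0, q}. set p)"
      using assms(5) by (simp only: UN_insert UN_empty Un_empty_right)
    show "set p \<inter> set r \<subseteq> {u, v}" if "p \<in> {p', q'}" "r \<in> {p', q'}" "p \<noteq> r" for p r
      using that assms(6) by blast
    show "[u, v] \<notin> (P - {p0, q}) \<inter> {p', q'}" using assms(8) by blast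
  qed simp
  then show False using no_cover by blast
qed

text \<open>
  The path edges other than \<open>xy\<close>, oriented so that \<open>(w, w') \<in> S\<close> with \<open>x \<sim> w\<close> and \<open>y \<sim> w'\<close>
  allows \<open>xy\<close> and \<open>ww'\<close> to be exchanged for \<open>xw\<close> and \<open>yw'\<close>: along the broken path edges are
  read forwards, along all others backwards.
\<close>

definition S :: "('a \<times> 'a) set" where
  "S = steps (a @ [x]) \<union> steps (y # b) \<union> (\<Union>q\<in>P - {p0}. (steps q)\<inverse>)"

lemma finite_S: "finite S"
  unfolding S_def using finite_P by simp

lemma ends_in_V: "{u, v} \<subseteq> V"
  using path_between_ends[OF path_P[OF broken]] broken cover_V by blast

text \<open>The interiors of the paths partition \<open>V - {u, v}\<close>.\<close>

lemma sum_length: "(\<Sum>p\<in>P. length p - 2) = card V - 2"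
proof -
  have *: "length p - 2 = card (set p - {u, v})" if "p \<in> P" for p
    using path_P[OF that] uv path_between_ends[OF path_P[OF that]]
    by (simp add: path_between_def distinct_card card_Diff_subset)
  have "(\<Sum>p\<in>P. length p - 2) = (\<Sum>p\<in>P. card (set p - {u, v}))"
    using * by simp
  also have "\<dots> = card (\<Union>p\<in>P. set p - {u, v})"
    using finite_P disjoint_P by (intro card_UN_disjoint[symmetric]) blast+
  also have "(\<Union>p\<in>P. set p - {u, v}) = V - {u, v}"
    using cover_V by blast
  also have "card \<dots> = card V - 2"
    using ends_in_V uv by (subst card_Diff_subset) auto
  finally show ?thesis .
qed

text \<open>A path has one edge more than it has interior vertices, so the cover has
  \<open>card V - 2 + t\<close> edges in all; \<open>S\<close> leaves out \<open>xy\<close>.\<close>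

lemma card_S: "card S + 3 \<le> card V + t"
proof -
  have len: "2 \<le> length p" if "p \<in> P" for p
    using path_between_length[OF path_P[OF that] uv] .
  have "card S \<le> card (steps (a @ [x])) + card (steps (y # b)) +
      card (\<Union>q\<in>P - {p0}. (steps q)\<inverse>)"
    unfolding S_def by (meson card_Un_le add_mono order_trans le_refl)
  also have "\<dots> \<le> length a + length b + (\<Sum>q\<in>P - {p0}. length q - 1)"
  proof (intro add_mono)
    show "card (steps (a @ [x])) \<le> length a" using card_steps[of "a @ [x]"] by simp
    show "card (steps (y # b)) \<le> length b" using card_steps[of "y # b"] by simp
    have "card (\<Union>q\<in>P - {p0}. (steps q)\<inverse>) \<le> (\<Sum>q\<in>P - {p0}. card ((steps q)\<inverse>))"
      using finite_P by (intro card_UN_le) auto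
    also have "\<dots> \<le> (\<Sum>q\<in>P - {p0}. length q - 1)"
      using card_steps by (intro sum_mono) simp
    finally show "card (\<Union>q\<in>P - {p0}. (steps q)\<inverse>) \<le> (\<Sum>q\<in>P - {p0}. length q - 1)" .
  qed
  finally have 1: "card S \<le> length a + length b + (\<Sum>q\<in>P - {p0}. length q - 1)" .
  have "(\<Sum>q\<in>P. length q - 1) = length p0 - 1 + (\<Sum>q\<in>P - {p0}. length q - 1)"
    using finite_P broken by (subst sum.remove[of P p0]) auto
  moreover have "(\<Sum>q\<in>P. length q - 1) = (\<Sum>q\<in>P. (length q - 2) + 1)"
    using len by (intro sum.cong refl) (metis Suc_1 Suc_diff_Suc Suc_eq_plus1 Suc_le_lessD diff_Suc_Suc numeral_2_eq_2)
  moreover have "\<dots> = card V - 2 + t"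
    by (simp only: sum.distrib sum_length) (simp add: card_P)
  moreover have "2 \<le> card V"
    using card_mono[OF finite_V ends_in_V] uv by simp
  ultimately show ?thesis using 1 by simp
qed

text \<open>
  If \<open>[u, v]\<close> is one of the paths and \<open>x = u\<close>, rerouting through the last edge of another path
  would create a second copy of \<open>[u, v]\<close>; the extra conditions below discard such edges.
\<close>

definition A :: "('a \<times> 'a) set" where
  "A = {(w, w') \<in> S. (x, w) \<in> E \<and> (w = v \<and> x = u \<and> [u, v] \<in> P \<longrightarrow> w' = u)}"

definition B :: "('a \<times> 'a) set" where
  "B = {(w, w') \<in> S. (y, w') \<in> E \<and> (w' = u \<and> y = v \<and> [u, v] \<in> P \<longrightarrow> w = v)}"

lemma other_path: obtains q where "q \<in> P" "q \<noteq> p0"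
proof -
  have "card (P - {p0}) \<noteq> 0" using card_P broken finite_P t by (simp add: card_Diff_singleton)
  then have "P - {p0} \<noteq> {}" by (metis card.empty)
  then show ?thesis using that by blast
qed

lemma last_b: "last (y # b) = v" and hd_a: "hd (a @ [x]) = u"
  using path_right path_left by (simp_all add: path_between_def)

text \<open>This makes the degree of \<open>x\<close> at most \<open>card A\<close>. A neighbour
  other than \<open>v\<close> has a successor within its half of \<open>p0\<close>, or a predecessor
  on another path; \<open>v\<close> is the start of a backward edge of some other path.\<close>

lemma neighbours_x: "E `` {x} \<subseteq> fst ` A"
proof
  fix w assume "w \<in> E `` {x}"
  then have xw: "(x, w) \<in> E" by simp
  then have "w \<in> V" using edges_in by blast
  then obtain p where p: "p \<in> P" "w \<in> set p" using cover_V by blast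
  have "w \<noteq> y" using xw nonedge by auto
  have "\<exists>w'. (w, w') \<in> S \<and> (w = v \<and> x = u \<and> [u, v] \<in> P \<longrightarrow> w' = u)"
  proof (cases "w = v")
    case wv: True
    show ?thesis
    proof (cases "x = u \<and> [u, v] \<in> P")
      case True
      \<comment> \<open>Here \<open>A\<close> admits \<open>v\<close> only through the edge of the
        path \<open>[u, v]\<close>. That path is not broken, since
        \<open>y \<noteq> v\<close>.\<close>
      have "[u, v] \<noteq> p0"
        using True wv \<open>w \<noteq> y\<close> last_b by (cases a) auto
      moreover have "(u, v) \<in> steps [u, v]" by (simp add: steps_def)
      ultimately have "(v, u) \<in> S" using True unfolding S_def by blast
      then show ?thesis using wv by blast
    next
      case False
      obtain q where q: "q \<in> P" "q \<noteq> p0" by (rule other_path)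
      have "v \<in> set q" "v \<noteq> hd q"
        using path_P[OF q(1)] uv by (auto simp: path_between_def)
      then obtain w' where "(w', v) \<in> steps q" by (rule steps_predecessor)
      then have "(v, w') \<in> S" using q unfolding S_def by blast
      then show ?thesis using False wv by blast
    qed
  next
    case wv: False
    have "\<exists>w'. (w, w') \<in> S"
    proof (cases "w \<in> set p0")
      case True
      show ?thesis
      proof (cases "w \<in> set (y # b)")
        case True
        then obtain w' where "(w, w') \<in> steps (y # b)"
          using steps_successor[of w "y # b"] last_b wv by metis
        then show ?thesis unfolding S_def by blast
      next
        case False
        have "w \<noteq> x" using xw irrefl_E by (auto simp: irrefl_def)
        with False True have "w \<in> set (a @ [x])" "w \<noteq> last (a @ [x])" by auto
        then obtain w' where "(w, w') \<in> steps (a @ [x])" by (rule steps_successor)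
        then show ?thesis unfolding S_def by blast
      qed
    next
      case False
      then have "p \<noteq> p0" "w \<noteq> hd p"
        using p path_P[OF p(1)] path_between_ends[OF path_P[OF broken]]
        by (auto simp: path_between_def)
      then obtain w' where "(w', w) \<in> steps p" using p(2) steps_predecessor by metis
      then show ?thesis using p \<open>p \<noteq> p0\<close> unfolding S_def by blast
    qed
    then show ?thesis using wv by blast
  qed
  then obtain w' where "(w, w') \<in> A" using xw unfolding A_def by blast
  then show "w \<in> fst ` A" by force
qed

text \<open>The mirror image of \<open>neighbours_x\<close>: predecessors on \<open>p0\<close>,
  successors on the other paths, and \<open>u\<close> in the role of \<open>v\<close>.\<close>

lemma neighbours_y: "E `` {y} \<subseteq> snd ` B"
proof
  fix w assume "w \<in> E `` {y}"
  then have yw: "(y, w) \<in> E" by simp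
  then have "w \<in> V" using edges_in by blast
  then obtain p where p: "p \<in> P" "w \<in> set p" using cover_V by blast
  have "w \<noteq> x" using yw nonedge' by auto
  have "\<exists>w'. (w', w) \<in> S \<and> (w = u \<and> y = v \<and> [u, v] \<in> P \<longrightarrow> w' = v)"
  proof (cases "w = u")
    case wu: True
    show ?thesis
    proof (cases "y = v \<and> [u, v] \<in> P")
      case True
      have "[u, v] \<noteq> p0"
        using True wu \<open>w \<noteq> x\<close> hd_a by (cases a) auto
      moreover have "(u, v) \<in> steps [u, v]" by (simp add: steps_def)
      ultimately have "(v, u) \<in> S" using True unfolding S_def by blast
      then show ?thesis using wu by blast
    next
      case False
      obtain q where q: "q \<in> P" "q \<noteq> p0" by (rule other_path)
      have "u \<in> set q" "u \<noteq> last q"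
        using path_P[OF q(1)] uv by (auto simp: path_between_def)
      then obtain w' where "(u, w') \<in> steps q" by (rule steps_successor)
      then have "(w', u) \<in> S" using q unfolding S_def by blast
      then show ?thesis using False wu by blast
    qed
  next
    case wu: False
    have "\<exists>w'. (w', w) \<in> S"
    proof (cases "w \<in> set p0")
      case True
      show ?thesis
      proof (cases "w \<in> set (a @ [x])")
        case True
        then obtain w' where "(w', w) \<in> steps (a @ [x])"
          using steps_predecessor[of w "a @ [x]"] hd_a wu by metis
        then show ?thesis unfolding S_def by blast
      next
        case False
        have "w \<noteq> y" using yw irrefl_E by (auto simp: irrefl_def)
        with False True have "w \<in> set (y # b)" "w \<noteq> hd (y # b)" by auto
        then obtain w' where "(w', w) \<in> steps (y # b)" by (rule steps_predecessor)
        then show ?thesis unfolding S_def by blast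
      qed
    next
      case False
      then have "p \<noteq> p0" "w \<noteq> last p"
        using p path_P[OF p(1)] path_between_ends[OF path_P[OF broken]]
        by (auto simp: path_between_def)
      then obtain w' where "(w, w') \<in> steps p" using p(2) steps_successor by metis
      then show ?thesis using p \<open>p \<noteq> p0\<close> unfolding S_def by blast
    qed
    then show ?thesis using wu by blast
  qed
  then obtain w' where "(w', w) \<in> B" using yw unfolding B_def by blast
  then show "w \<in> snd ` B" by force
qed

text \<open>The segment from \<open>w'\<close> to \<open>x\<close> can be reversed: go from
  \<open>u\<close> to \<open>w\<close>, jump to \<open>x\<close>, run back to \<open>w'\<close>,
  jump to \<open>y\<close> and continue to \<open>v\<close>.\<close>

lemma no_crossing_left:
  assumes "(w, w') \<in> steps (a @ [x])" "(x, w) \<in> E" "(y, w') \<in> E"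
  shows False
proof -
  obtain c d where ax: "a @ [x] = (c @ [w]) @ (w' # d)"
    using assms(1) steps_iff[of w w'] by auto
  have L: "path_between E u ((c @ [w]) @ (w' # d)) x" using path_left ax by simp
  have c: "path_between E u (c @ [w]) w" and d: "path_between E w' (w' # d) x"
    and dj: "set (c @ [w]) \<inter> set (w' # d) = {}"
    using path_between_split[OF L] by simp_all
  have set: "set a \<union> {x} = set (c @ [w]) \<union> set (w' # d)"
    using arg_cong[OF ax, of set] by auto
  have "path_between E u ((c @ [w]) @ rev (w' # d)) w'"
    using path_between_append[OF c path_between_rev[OF sym_E d]] assms(2) dj sym_E
    by (auto simp: sym_def)
  then have "path_between E u (((c @ [w]) @ rev (w' # d)) @ (y # b)) v"
  proof (rule path_between_append[OF _ path_right])
    show "(w', y) \<in> E" using assms(3) sym_E by (auto simp: sym_def)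
    have "set ((c @ [w]) @ rev (w' # d)) = set a \<union> {x}" using set by (simp only: set_append set_rev)
    then show "set ((c @ [w]) @ rev (w' # d)) \<inter> set (y # b) = {}"
      using distinct_p0 xy by auto
  qed
  then show False
  proof (rule replace_one)
    show "set (((c @ [w]) @ rev (w' # d)) @ (y # b)) = set p0"
      using set by (auto simp: insert_commute)
    show "((c @ [w]) @ rev (w' # d)) @ (y # b) \<noteq> [u, v]"
      by (auto dest: arg_cong[of _ _ length])
  qed
qed

text \<open>The segment from \<open>y\<close> to \<open>w\<close> can be reversed: go from
  \<open>u\<close> to \<open>x\<close>, jump to \<open>w\<close>, run back to \<open>y\<close>, jump
  to \<open>w'\<close> and continue to \<open>v\<close>.\<close>

lemma no_crossing_right:
  assumes "(w, w') \<in> steps (y # b)" "(x, w) \<in> E" "(y, w') \<in> E"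
  shows False
proof -
  obtain c d where yb: "y # b = (c @ [w]) @ (w' # d)"
    using assms(1) steps_iff[of w w'] by auto
  have R: "path_between E y ((c @ [w]) @ (w' # d)) v" using path_right yb by simp
  have c: "path_between E y (c @ [w]) w" and d: "path_between E w' (w' # d) v"
    and dj: "set (c @ [w]) \<inter> set (w' # d) = {}"
    using path_between_split[OF R] by simp_all
  have set: "set b \<union> {y} = set (c @ [w]) \<union> set (w' # d)"
    using arg_cong[OF yb, of set] by auto
  have "path_between E w (rev (c @ [w]) @ (w' # d)) v"
    using path_between_append[OF path_between_rev[OF sym_E c] d] assms(3) dj by auto
  then have "path_between E u ((a @ [x]) @ (rev (c @ [w]) @ (w' # d))) v"
  proof (rule path_between_append[OF path_left])
    show "(x, w) \<in> E" by fact
    have "set (rev (c @ [w]) @ (w' # d)) = set b \<union> {y}" using set by (simp only: set_append set_rev)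
    then show "set (a @ [x]) \<inter> set (rev (c @ [w]) @ (w' # d)) = {}"
      using distinct_p0 xy by auto
  qed
  then show False
  proof (rule replace_one)
    show "set ((a @ [x]) @ (rev (c @ [w]) @ (w' # d))) = set p0"
      using set by (auto simp: insert_commute)
    show "(a @ [x]) @ (rev (c @ [w]) @ (w' # d)) \<noteq> [u, v]"
      by (auto dest: arg_cong[of _ _ length])
  qed
qed

text \<open>The two paths can swap their tails: \<open>p0\<close> up to \<open>x\<close> continues
  with \<open>q\<close> from \<open>w\<close>, and \<open>q\<close> up to \<open>w'\<close>
  continues with \<open>p0\<close> from \<open>y\<close>. The last two assumptions are the extra
  conditions in \<open>A\<close> and \<open>B\<close>.\<close>

lemma no_crossing_other:
  assumes "q \<in> P" "q \<noteq> p0" "(w', w) \<in> steps q" "(x, w) \<in> E" "(y, w') \<in> E"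
    and "w = v \<and> x = u \<and> [u, v] \<in> P \<longrightarrow> w' = u"
    and "w' = u \<and> y = v \<and> [u, v] \<in> P \<longrightarrow> w = v"
  shows False
proof -
  obtain c d where q: "q = (c @ [w']) @ (w # d)"
    using assms(3) steps_iff[of w' w] by auto
  have Q: "path_between E u ((c @ [w']) @ (w # d)) v"
    using path_other[OF assms(1,2)] q by simp
  have c: "path_between E u (c @ [w']) w'" and d: "path_between E w (w # d) v"
    and dj: "set (c @ [w']) \<inter> set (w # d) = {}"
    using path_between_split[OF Q] by simp_all
  have ends: "u \<in> set (a @ [x])" "v \<in> set (y # b)" "u \<in> set (c @ [w'])" "v \<in> set (w # d)"
    using path_between_ends[OF path_left] path_between_ends[OF path_right]
      path_between_ends[OF c] path_between_ends[OF d] by blast+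
  have dj0: "set (a @ [x]) \<inter> set (y # b) = {}" using distinct_p0 xy by auto
  have meet: "(set (a @ [x]) \<union> set (y # b)) \<inter> (set (c @ [w']) \<union> set (w # d)) \<subseteq> {u, v}"
    using disjoint_P[OF broken assms(1)] assms(2) q by auto
  let ?p = "(a @ [x]) @ (w # d)" and ?q = "(c @ [w']) @ (y # b)"
  have p: "path_between E u ?p v"
  proof (rule path_between_append[OF path_left d assms(4)])
    show "set (a @ [x]) \<inter> set (w # d) = {}" using meet dj dj0 ends by blast
  qed
  have q': "path_between E u ?q v"
  proof (rule path_between_append[OF c path_right])
    show "(w', y) \<in> E" using assms(5) sym_E by (auto simp: sym_def)
    show "set (c @ [w']) \<inter> set (y # b) = {}" using meet dj dj0 ends by blast
  qed
  have sets: "set ?p = set (a @ [x]) \<union> set (w # d)" "set ?q = set (c @ [w']) \<union> set (y # b)"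
    by (simp_all only: set_append)
  show False
  proof (rule replace_two[OF assms(1,2) p q'])
    have "set p0 = set (a @ [x]) \<union> set (y # b)" "set q = set (c @ [w']) \<union> set (w # d)"
      using q by auto
    then show "set ?p \<union> set ?q = set p0 \<union> set q" using sets by blast
    show "set ?p \<inter> set ?q \<subseteq> {u, v}" using sets meet dj dj0 by blast
    \<comment> \<open>Otherwise \<open>x = u\<close> and \<open>w = v\<close>, so the condition from
      \<open>A\<close> gives \<open>w' = u = x\<close>, and the edge \<open>yw'\<close> would be the
      missing edge \<open>yx\<close>.\<close>
    have "?p \<noteq> [u, v]" if "[u, v] \<in> P"
    proof
      assume *: "?p = [u, v]"
      then have "x = u" "w = v" by (cases a; auto)+
      then show False using assms(5,6) that nonedge' by auto
    qed
    moreover have "?q \<noteq> [u, v]" if "[u, v] \<in> P"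
    proof
      assume *: "?q = [u, v]"
      then have "w' = u" "y = v" by (cases c; auto)+
      then show False using assms(4,7) that nonedge by auto
    qed
    ultimately show "[u, v] \<in> P \<Longrightarrow> ?p \<noteq> [u, v] \<and> ?q \<noteq> [u, v]" by blast
    \<comment> \<open>Equal paths would both be \<open>[u, v]\<close>, which makes the edge
      \<open>xw\<close> the missing edge \<open>xy\<close>.\<close>
    show "?p \<noteq> ?q"
    proof
      assume eq: "?p = ?q"
      then have "set ?p = set ?q" by simp
      then have "set ?p \<subseteq> {u, v}" using sets meet dj dj0 by blast
      then have "?p = [u, v]" using path_between_doubleton[OF p uv] by blast
      moreover from this have "?q = [u, v]" using eq by simp
      ultimately have "x = u" "w' = u" "w = v" "y = v" by (cases a; cases c; auto)+
      then show False using nonedge assms(4) by simp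
    qed
  qed
qed

text \<open>An element of both \<open>A\<close> and \<open>B\<close> would be a crossing, so the two
  sets are disjoint subsets of \<open>S\<close>, and they are at least as large as the degrees of
  \<open>x\<close> and \<open>y\<close>.\<close>

lemma degree_sum: "card (E `` {x}) + card (E `` {y}) + 3 \<le> card V + t"
proof -
  have "A \<subseteq> S" "B \<subseteq> S" unfolding A_def B_def by blast+
  then have fin: "finite A" "finite B" using finite_S finite_subset by blast+
  have disj: "A \<inter> B = {}"
  proof (rule ccontr)
    assume "A \<inter> B \<noteq> {}"
    then obtain w w' where w: "(w, w') \<in> A" "(w, w') \<in> B" by auto
    then consider "(w, w') \<in> steps (a @ [x])" | "(w, w') \<in> steps (y # b)"
      | q where "q \<in> P" "q \<noteq> p0" "(w', w) \<in> steps q"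
      unfolding A_def S_def by blast
    then show False
      using w no_crossing_left[of w w'] no_crossing_right[of w w'] no_crossing_other[of _ w' w]
      unfolding A_def B_def by cases blast+
  qed
  have "card (E `` {x}) \<le> card A"
    using neighbours_x fin(1) by (meson card_image_le card_mono finite_imageI order_trans)
  moreover have "card (E `` {y}) \<le> card B"
    using neighbours_y fin(2) by (meson card_image_le card_mono finite_imageI order_trans)
  moreover have "card A + card B \<le> card S"
    using card_mono[OF finite_S, of "A \<union> B"] \<open>A \<subseteq> S\<close> \<open>B \<subseteq> S\<close> disj fin
    by (simp add: card_Un_disjoint)
  ultimately show ?thesis using card_S by simp
qed

end

section \<open>Edge-maximal graphs without a cover and their vertices of small degree\<close>

lemma successively_iff_steps: "successively (\<lambda>a b. (a, b) \<in> R) p \<longleftrightarrow> steps p \<subseteq> R"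
  by (induction p rule: induct_list012) (auto simp: steps_def)

text \<open>Take \<open>t - 1\<close> paths with a single interior vertex each, and one path through
  all remaining vertices, of which \<open>t + 2 \<le> card V\<close> leaves at least one.\<close>

lemma complete_graph_cover:
  assumes "finite V" "u \<in> V" "v \<in> V" "u \<noteq> v" "1 \<le> t" "t + 2 \<le> card V"
  shows "\<exists>P. disjoint_path_cover (V \<times> V - Id) V t u v P"
proof -
  have "t - 1 \<le> card (V - {u, v})"
    using assms by (simp add: card_Diff_subset)
  then obtain T where T: "T \<subseteq> V - {u, v}" "card T = t - 1"
    using obtain_subset_with_card_n by metis
  have fT: "finite T" using T(1) assms(1) finite_subset by blast
  obtain ys where ys: "set ys = V - {u, v} - T" "distinct ys"
    using finite_distinct_list[of "V - {u, v} - T"] assms(1) by auto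
  have "card (V - {u, v} - T) = card V - 2 - (t - 1)"
    using T assms fT by (simp add: card_Diff_subset)
  then have "card (set ys) \<noteq> 0" using ys(1) assms(5,6) by simp
  then have "ys \<noteq> []" by auto
  let ?q = "u # ys @ [v]" and ?p = "\<lambda>w. [u, w, v]"
  let ?P = "insert ?q (?p ` T)"
  have "?q \<notin> ?p ` T"
  proof
    assume "?q \<in> ?p ` T"
    then obtain w where "w \<in> T" "ys = [w]" by auto
    then show False using ys(1) by auto
  qed
  moreover have "card (?p ` T) = t - 1"
    using T(2) by (subst card_image) (auto simp: inj_on_def)
  ultimately have "card ?P = t" using fT assms(5) by simp
  moreover have "path_between (V \<times> V - Id) u ?q v"
  proof -
    have "steps p \<subseteq> V \<times> V - Id" if "set p \<subseteq> V" "distinct p" for p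
      using that by (induction p rule: induct_list012) (auto simp: steps_def)
    moreover have "set ?q \<subseteq> V" "distinct ?q" using ys assms(2-4) by auto
    ultimately have "steps ?q \<subseteq> V \<times> V - Id" by blast
    then show ?thesis
      using \<open>distinct ?q\<close> unfolding path_between_def successively_iff_steps by simp
  qed
  moreover have "path_between (V \<times> V - Id) u (?p w) v" if "w \<in> T" for w
    using that T(1) assms(2-4) by (auto simp: path_between_def)
  ultimately have "card ?P = t" "\<forall>p\<in>?P. path_between (V \<times> V - Id) u p v" by simp_all
  moreover have "(\<Union>p\<in>?P. set p) = V"
    using ys(1) T(1) assms(2,3) by auto
  moreover have "\<forall>p\<in>?P. \<forall>q\<in>?P. p \<noteq> q \<longrightarrow> set p \<inter> set q \<subseteq> {u, v}"
    using ys(1) by auto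
  moreover have "finite ?P" using fT by simp
  ultimately have "disjoint_path_cover (V \<times> V - Id) V t u v ?P"
    unfolding disjoint_path_cover_def by (intro conjI)
  then show ?thesis by blast
qed

text \<open>Some path of the new cover must traverse the added edge, in one direction or the other;
  either way \<open>broken_cover\<close> applies.\<close>

lemma cover_stability:
  assumes "finite V" "R \<subseteq> V \<times> V" "sym R" "irrefl R" "u \<noteq> v" "x \<noteq> y" "(x, y) \<notin> R" "2 \<le> t"
    and no_cover: "\<And>P. \<not> disjoint_path_cover R V t u v P"
    and cover: "disjoint_path_cover (insert (x, y) (insert (y, x) R)) V t u v P"
  shows "card (R `` {x}) + card (R `` {y}) + 3 \<le> card V + t"
proof -
  let ?R = "insert (x, y) (insert (y, x) R)"
  obtain p where p: "p \<in> P" "path_between ?R u p v" "\<not> path_between R u p v"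
    using cover no_cover[of P] unfolding disjoint_path_cover_def by blast
  then have "steps p \<subseteq> ?R" "\<not> steps p \<subseteq> R"
    unfolding path_between_def successively_iff_steps by blast+
  then consider "(x, y) \<in> steps p" | "(y, x) \<in> steps p" by blast
  then show ?thesis
  proof cases
    case 1
    then obtain a b where "p = a @ x # y # b" by (auto simp: steps_iff)
    then interpret broken_cover R V t u v x y P a b
      using assms p(1) by unfold_locales auto
    show ?thesis by (rule degree_sum)
  next
    case 2
    then obtain a b where "p = a @ y # x # b" by (auto simp: steps_iff)
    then interpret broken_cover R V t u v y x P a b
      using assms p(1) by unfold_locales (auto simp: insert_commute sym_def)
    show ?thesis using degree_sum by simp
  qed
qed

text \<open>The number \<open>k\<close> is the degree of \<open>x\<close> in the maximal graph
  \<open>H\<close>, and \<open>D\<close> consists of the non-neighbours of \<open>y\<close> other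
  than \<open>y\<close>. Bounds on degrees in \<open>H\<close> pass to \<open>R\<close> because
  \<open>R \<subseteq> H\<close>.\<close>

lemma many_small_degrees:
  assumes "finite V" "R \<subseteq> V \<times> V" "sym R" "irrefl R" "u \<in> V" "v \<in> V" "u \<noteq> v" "2 \<le> t"
    and "t + 2 \<le> card V"
    and no_cover: "\<And>P. \<not> disjoint_path_cover R V t u v P"
  obtains k x D where "x \<in> V" "D \<subseteq> V" "card (R `` {x}) \<le> k" "2 * k + 3 \<le> card V + t"
    "k + 2 \<le> card D + t" "\<And>w. w \<in> D \<Longrightarrow> card (R `` {w}) \<le> k"
proof -
  define C where
    "C = {H. R \<subseteq> H \<and> H \<subseteq> V \<times> V - Id \<and> sym H \<and> (\<forall>P. \<not> disjoint_path_cover H V t u v P)}"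
  have "C \<subseteq> Pow (V \<times> V)" unfolding C_def by blast
  then have "finite C" using assms(1) by (meson finite_Pow_iff finite_SigmaI finite_subset)
  moreover have "R \<in> C" using assms(2-4) no_cover by (auto simp: C_def irrefl_def)
  ultimately obtain H where "H \<in> C" and max: "\<forall>H'\<in>C. H \<subseteq> H' \<longrightarrow> H = H'"
    using finite_has_maximal2[of C R] by blast
  then have H: "R \<subseteq> H" "H \<subseteq> V \<times> V - Id" "sym H"
    and no_cover_H: "\<And>P. \<not> disjoint_path_cover H V t u v P"
    unfolding C_def by blast+
  have fin: "finite (H `` {z})" for z
    by (rule finite_subset[of _ V]) (use H assms(1) in auto)
  let ?d = "\<lambda>z. card (H `` {z})"
  let ?N = "{(x, y). x \<in> V \<and> y \<in> V \<and> x \<noteq> y \<and> (x, y) \<notin> H}"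
  have fN: "finite ?N" by (rule finite_subset[of _ "V \<times> V"]) (use assms(1) in auto)
  have "?N \<noteq> {}"
  proof
    assume "?N = {}"
    then have "H = V \<times> V - Id" using H by auto
    then show False
      using no_cover_H complete_graph_cover[of V u v t] assms(1,5-9) by auto
  qed
  then have "Max ((\<lambda>(x, y). ?d x + ?d y) ` ?N) \<in> (\<lambda>(x, y). ?d x + ?d y) ` ?N"
    using fN by (intro Max_in) auto
  then obtain x' y' where xy': "(x', y') \<in> ?N"
    and "?d x' + ?d y' = Max ((\<lambda>(x, y). ?d x + ?d y) ` ?N)" by force
  then have max': "?d w + ?d z \<le> ?d x' + ?d y'" if "(w, z) \<in> ?N" for w z
    using that fN by (metis (mono_tags, lifting) Max_ge case_prod_conv finite_imageI image_eqI)
  have symH: "(w, z) \<in> H \<Longrightarrow> (z, w) \<in> H" for w z using H by (auto simp: sym_def)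
  \<comment> \<open>Making \<open>x\<close> the vertex of smaller degree is what turns the bound on
    the degree sum into \<open>2 * k + 3 \<le> card V + t\<close>.\<close>
  obtain x y where xy: "(x, y) \<in> ?N" "?d x \<le> ?d y"
    and best: "\<And>w z. (w, z) \<in> ?N \<Longrightarrow> ?d w + ?d z \<le> ?d x + ?d y"
  proof (cases "?d x' \<le> ?d y'")
    case True
    then show ?thesis using that xy' max' by blast
  next
    case False
    moreover have "(y', x') \<in> ?N" using xy' symH by auto
    ultimately show ?thesis using that[of y' x'] max' by (simp add: add.commute)
  qed
  \<comment> \<open>By maximality of \<open>H\<close>, adding \<open>xy\<close> creates a cover, so
    \<open>cover_stability\<close> bounds the degree sum.\<close>
  define H' where "H' = insert (x, y) (insert (y, x) H)"
  have "H \<noteq> H'" "H \<subseteq> H'" using xy by (auto simp: H'_def)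
  then have "H' \<notin> C" using max by blast
  moreover have "R \<subseteq> H'" "H' \<subseteq> V \<times> V - Id" "sym H'"
    using H(1,2) xy symH by (auto simp: H'_def sym_def)
  ultimately obtain P where P: "disjoint_path_cover H' V t u v P"
    unfolding C_def by blast
  have sum: "?d x + ?d y + 3 \<le> card V + t"
    by (rule cover_stability[OF assms(1) _ H(3) _ assms(7) _ _ assms(8) no_cover_H P[unfolded H'_def]])
      (use H(2) xy in \<open>auto simp: irrefl_def\<close>)
  let ?D = "V - insert y (H `` {y})"
  have "insert y (H `` {y}) \<subseteq> V" using H xy by auto
  moreover have "card (insert y (H `` {y})) = Suc (?d y)"
    using H(2) fin by (subst card_insert_disjoint) auto
  ultimately have "card ?D = card V - Suc (?d y)" "Suc (?d y) \<le> card V"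
    using assms(1) fin card_mono[of V "insert y (H `` {y})"] by (simp_all add: card_Diff_subset)
  then have "?d x + 2 \<le> card ?D + t" using sum by linarith
  moreover have RH: "card (R `` {w}) \<le> ?d w" for w
    using H fin by (intro card_mono) auto
  moreover have "card (R `` {w}) \<le> ?d x" if "w \<in> ?D" for w
  proof -
    \<comment> \<open>The pair \<open>w\<close>, \<open>y\<close> competes with \<open>x\<close>,
      \<open>y\<close> for the largest sum, and the degree of \<open>y\<close> cancels.\<close>
    have "(w, y) \<in> ?N" using that xy symH by auto
    then show ?thesis using best RH[of w] by fastforce
  qed
  moreover have "x \<in> V" using xy by blast
  moreover have "2 * ?d x + 3 \<le> card V + t" using sum xy(2) by linarith
  ultimately show ?thesis using that[of x ?D "?d x"] by blast
qed

section \<open>Clique counts\<close>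

text \<open>A clique either avoids \<open>D\<close> or contains some \<open>w\<close> in
  \<open>D\<close>, and then its other \<open>s - 1\<close> vertices are neighbours of
  \<open>w\<close>. Cliques meeting \<open>D\<close> more than once are counted repeatedly.\<close>

lemma num_cliques_le:
  fixes G :: "'a pair_pre_digraph"
  defines "V \<equiv> pverts G" and "R \<equiv> parcs G"
  assumes "finite V" "R \<subseteq> V \<times> V" "D \<subseteq> V" "0 < s"
  shows "num_cliques s G \<le> (card V - card D choose s) + (\<Sum>w\<in>D. card (R `` {w}) choose (s - 1))"
proof -
  let ?N = "\<lambda>w. {T. T \<subseteq> R `` {w} \<and> card T = s - 1}"
  have fN: "finite (R `` {w})" for w
    by (rule finite_subset[of _ V]) (use assms(3,4) in auto)
  have fD: "finite D" using assms(3,5) finite_subset by blast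
  have "cliques s G \<subseteq> {S. S \<subseteq> V - D \<and> card S = s} \<union> (\<Union>w\<in>D. insert w ` ?N w)"
  proof
    fix S assume S: "S \<in> cliques s G"
    then have fS: "finite S" using assms(3) finite_subset by (auto simp: cliques_def V_def R_def)
    show "S \<in> {S. S \<subseteq> V - D \<and> card S = s} \<union> (\<Union>w\<in>D. insert w ` ?N w)"
    proof (cases "S \<inter> D = {}")
      case True
      then show ?thesis using S by (auto simp: cliques_def V_def R_def)
    next
      case False
      then obtain w where w: "w \<in> S" "w \<in> D" by blast
      then have "S - {w} \<in> ?N w" using S fS by (auto simp: cliques_def V_def R_def)
      moreover have "S = insert w (S - {w})" using w by blast
      ultimately show ?thesis using w(2) by blast
    qed
  qed
  then have "card (cliques s G)
      \<le> card ({S. S \<subseteq> V - D \<and> card S = s} \<union> (\<Union>w\<in>D. insert w ` ?N w))"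
    using assms(3) fD fN by (intro card_mono) auto
  also have "\<dots> \<le> card {S. S \<subseteq> V - D \<and> card S = s} + card (\<Union>w\<in>D. insert w ` ?N w)"
    by (rule card_Un_le)
  also have "\<dots> \<le> (card V - card D choose s) + (\<Sum>w\<in>D. card (R `` {w}) choose (s - 1))"
  proof (intro add_mono)
    show "card {S. S \<subseteq> V - D \<and> card S = s} \<le> (card V - card D choose s)"
      using assms(3,5) fD by (simp add: n_subsets card_Diff_subset)
    have "card (\<Union>w\<in>D. insert w ` ?N w) \<le> (\<Sum>w\<in>D. card (insert w ` ?N w))"
      using fD by (rule card_UN_le)
    also have "\<dots> \<le> (\<Sum>w\<in>D. card (?N w))"
      using fN by (intro sum_mono card_image_le) simp
    also have "\<dots> = (\<Sum>w\<in>D. card (R `` {w}) choose (s - 1))"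
      using fN by (simp add: n_subsets)
    finally show "card (\<Union>w\<in>D. insert w ` ?N w) \<le> (\<Sum>w\<in>D. card (R `` {w}) choose (s - 1))" .
  qed
  finally show ?thesis unfolding num_cliques_def .
qed

text \<open>The increments of \<open>f\<close> do not decrease. So a weak rise at \<open>k\<close>
  persists up to \<open>b\<close>, while a fall at \<open>k\<close> means that \<open>f\<close>
  falls all the way from \<open>a\<close>. Convexity is stated with sums because differences would
  truncate.\<close>

lemma convex_le_max_ends:
  fixes f :: "nat \<Rightarrow> nat"
  assumes convex: "\<And>k. a \<le> k \<Longrightarrow> k + 2 \<le> b \<Longrightarrow> 2 * f (Suc k) \<le> f k + f (k + 2)"
    and "a \<le> k" "k \<le> b"
  shows "f k \<le> max (f a) (f b)"
proof (cases "k < b \<and> f k \<le> f (Suc k)")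
  case True
  have up: "f j \<le> f (Suc j)" if "k \<le> j" "j < b" for j
    using that
  proof (induction j rule: dec_induct)
    case base
    then show ?case using True by simp
  next
    case (step i)
    then show ?case using convex[of i] assms(2) by simp
  qed
  have "f k \<le> f j" if "k \<le> j" "j \<le> b" for j
    using that
  proof (induction j rule: dec_induct)
    case (step i)
    then show ?case using up[of i] by simp
  qed simp
  then show ?thesis using assms(3) by (simp add: le_max_iff_disj)
next
  case False
  show ?thesis
  proof (cases "k = b")
    case True
    then show ?thesis by simp
  next
    case neq: False
    have down: "f (Suc j) \<le> f j" if "a \<le> j" "j \<le> k" for j
      using that(2,1)
    proof (induction j rule: inc_induct)
      case base
      then show ?case using False neq assms(3) by simp
    next
      case (step i)
      then show ?case using convex[of i] neq assms(3) by simp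
    qed
    have "f k \<le> f j" if "a \<le> j" "j \<le> k" for j
      using that(2,1)
    proof (induction j rule: inc_induct)
      case (step i)
      then show ?case using down[of i] by simp
    qed simp
    then show ?thesis using assms(2) by (simp add: le_max_iff_disj)
  qed
qed

text \<open>By Pascal's rule the second difference is \<open>m choose (s - 2)\<close> if
  \<open>s \<ge> 2\<close>, and 0 otherwise.\<close>

lemma choose_convex: "2 * (Suc m choose s) \<le> (m choose s) + (m + 2 choose s)"
proof (cases s)
  case (Suc r)
  then show ?thesis by (cases r) auto
qed simp

text \<open>Reflecting the argument preserves convexity of the first term. With
  \<open>c = k + 1 - t\<close>, the second difference of the other term is \<open>c\<close> times
  that of \<open>k choose r\<close>, plus twice an increment of the binomial; both are
  nonnegative.\<close>

lemma clique_bound_convex: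
  assumes "t \<le> Suc k" "k + 2 \<le> M"
  shows "2 * ((M - Suc k choose s) + (Suc k + 1 - t) * (Suc k choose r))
    \<le> ((M - k choose s) + (k + 1 - t) * (k choose r))
      + ((M - (k + 2) choose s) + (k + 2 + 1 - t) * (k + 2 choose r))"
proof -
  have "M - Suc k = Suc (M - (k + 2))" "M - k = M - (k + 2) + 2" using assms(2) by auto
  then have 1: "2 * (M - Suc k choose s) \<le> (M - (k + 2) choose s) + (M - k choose s)"
    using choose_convex[of "M - (k + 2)" s] by metis
  obtain c where c: "k + 1 - t = c" "Suc k + 1 - t = c + 1" "k + 2 + 1 - t = c + 2"
    using assms(1) by force
  have 2: "c * (2 * (Suc k choose r)) \<le> c * ((k choose r) + (k + 2 choose r))"
    by (intro mult_left_mono choose_convex) simp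
  have 3: "Suc k choose r \<le> k + 2 choose r" by (rule binomial_right_mono) simp
  show ?thesis using 1 2 3 unfolding c by (simp add: algebra_simps)
qed

section \<open>Minimum degree and coverability\<close>

lemma walk_of_path_between:
  assumes "path_between R u p v"
  shows "pawalk_verts u (zip p (tl p)) = p" "pcas u (zip p (tl p)) v" "set (zip p (tl p)) \<subseteq> R"
proof -
  have p: "p \<noteq> []" "hd p = u" "last p = v" using assms by (auto simp: path_between_def)
  show "pawalk_verts u (zip p (tl p)) = p"
    using p by (induction p arbitrary: u rule: induct_list012) auto
  show "pcas u (zip p (tl p)) v"
    using p by (induction p arbitrary: u rule: induct_list012) auto
  show "set (zip p (tl p)) \<subseteq> R"
    using assms by (simp add: path_between_def successively_iff_steps steps_def)
qed

text \<open>Passing from vertex lists to arc lists keeps the number of paths, because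
  \<open>pawalk_verts u\<close> recovers each list.\<close>

lemma coverableI:
  assumes "\<And>u v. u \<in> pverts G \<Longrightarrow> v \<in> pverts G \<Longrightarrow> u \<noteq> v
    \<Longrightarrow> \<exists>P. disjoint_path_cover (parcs G) (pverts G) t u v P"
  shows "one_to_one_disjoint_path_coverable t G"
  unfolding one_to_one_disjoint_path_coverable_def
proof (intro ballI impI)
  fix u v assume uv: "u \<in> pverts G" "v \<in> pverts G" "u \<noteq> v"
  then obtain P where P: "disjoint_path_cover (parcs G) (pverts G) t u v P"
    using assms by blast
  let ?w = "\<lambda>p. zip p (tl p)"
  have path: "path_between (parcs G) u p v" if "p \<in> P" for p
    using P that by (simp add: disjoint_path_cover_def)
  have verts: "pawalk_verts u (?w p) = p" if "p \<in> P" for p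
    using walk_of_path_between(1)[OF path[OF that]] .
  have "inj_on ?w P" by (rule inj_onI) (metis verts)
  then have "card (?w ` P) = t" using P by (simp add: card_image disjoint_path_cover_def)
  moreover have "finite (?w ` P)" using P by (simp add: disjoint_path_cover_def)
  moreover have "pre_digraph.apath (with_proj G) u (?w p) v" if "p \<in> P" for p
  proof -
    have "distinct p" using path[OF that] by (simp add: path_between_def)
    then show ?thesis
      using walk_of_path_between[OF path[OF that]] uv(1)
      unfolding pre_digraph.apath_def pre_digraph.awalk_def cas_with_proj_eq
        awalk_verts_with_proj_eq with_proj_simps by simp
  qed
  moreover have "\<exists>p\<in>?w ` P. w \<in> set (pawalk_verts u p)" if "w \<in> pverts G" for w
  proof -
    have "w \<in> (\<Union>p\<in>P. set p)" using that P by (simp add: disjoint_path_cover_def)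
    then obtain p where p: "p \<in> P" "w \<in> set p" by blast
    show ?thesis by (rule bexI[of _ "?w p"]) (use p verts in auto)
  qed
  moreover have "set (pawalk_verts u p) \<inter> set (pawalk_verts u q) \<subseteq> {u, v}"
    if pq: "p \<in> ?w ` P" "q \<in> ?w ` P" "p \<noteq> q" for p q
  proof -
    obtain p' q' where p': "p' \<in> P" "p = ?w p'" "q' \<in> P" "q = ?w q'" using pq by blast
    moreover have "p' \<noteq> q'" using pq(3) p' by blast
    ultimately have "set p' \<inter> set q' \<subseteq> {u, v}" using P by (simp add: disjoint_path_cover_def)
    then show ?thesis using p' verts by simp
  qed
  ultimately show "\<exists>P. finite P \<and> card P = t \<and>
      (\<forall>p\<in>P. pre_digraph.apath (with_proj G) u p v) \<and>
      (\<forall>w\<in>pverts G. \<exists>p\<in>P. w \<in> set (pawalk_verts u p)) \<and>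
      (\<forall>p\<in>P. \<forall>q\<in>P. p \<noteq> q \<longrightarrow>
        set (pawalk_verts u p) \<inter> set (pawalk_verts u q) \<subseteq> {u, v})"
    by (intro exI[of _ "?w ` P"] conjI ballI impI) (assumption | blast)+
qed

theorem theorem2p1:
  fixes G :: "'a pair_pre_digraph" and n s t \<delta> :: nat
  assumes "s \<ge> 2"
    and "2 \<le> t" and "t \<le> \<delta>" and "\<delta> \<le> (n + t - 3) div 2"
    and "pair_graph G"
    and "Digraph_Component.connected (with_proj G)"
    and "card (pverts G) = n"
    and "min_degree G = \<delta>"
    and "num_cliques s G > max (f2 n t \<delta> s) (g2 n t \<delta> s)"
  shows "one_to_one_disjoint_path_coverable t G"
proof (rule coverableI, rule ccontr)
  fix u v
  assume uv: "u \<in> pverts G" "v \<in> pverts G" "u \<noteq> v"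
    and none: "\<nexists>P. disjoint_path_cover (parcs G) (pverts G) t u v P"
  interpret pair_graph G by fact
  let ?V = "pverts G" and ?R = "parcs G"
  define h where "h = (n + t - 3) div 2"
  define r where "r = s - 1"
  \<comment> \<open>This is the clique bound as a function of \<open>k\<close>, without the
    contribution \<open>\<delta> choose r\<close> of one vertex of minimum degree.\<close>
  define \<phi> where "\<phi> k = (n + t - 2 - k choose s) + (k + 1 - t) * (k choose r)" for k
  have fV: "finite ?V" by (rule pair_finite_verts)
  have RV: "?R \<subseteq> ?V \<times> ?V" using wellformed' by auto
  have R: "sym ?R" "irrefl ?R"
    using pair_sym_arcs pair_no_loops[of "(w, w)" for w] by (auto simp: symmetric_def irrefl_def)
  have deg: "out_degree (with_proj G) w = card (?R `` {w})" for w
  proof -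
    have "bij_betw snd (out_arcs (with_proj G) w) (?R `` {w})"
      by (rule bij_betwI[where g = "Pair w"]) (auto simp: out_arcs_def)
    then show ?thesis unfolding out_degree_def by (rule bij_betw_same_card)
  qed
  have n: "t + 2 \<le> card ?V" using assms(2-4,7) by linarith
  obtain k x D where x: "x \<in> ?V" "card (?R `` {x}) \<le> k" and D: "D \<subseteq> ?V" "k + 2 \<le> card D + t"
    and k: "2 * k + 3 \<le> card ?V + t" and small: "\<And>w. w \<in> D \<Longrightarrow> card (?R `` {w}) \<le> k"
    using many_small_degrees[OF fV RV R uv assms(2) n] none by metis
  have min: "Min ((\<lambda>w. card (?R `` {w})) ` ?V) = \<delta>"
    using assms(8) unfolding min_degree_def deg .
  \<comment> \<open>The vertex \<open>x\<close> has degree at most \<open>k\<close> in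
    \<open>G\<close>, which bounds the minimum degree.\<close>
  have "\<delta> \<le> k"
    using min x fV by (metis (no_types, lifting) Min_le finite_imageI imageI order_trans)
  have "k \<le> h" using k assms(7) unfolding h_def by linarith
  have "\<delta> \<in> (\<lambda>w. card (?R `` {w})) ` ?V"
    using Min_in[of "(\<lambda>w. card (?R `` {w})) ` ?V"] min fV uv(1) by auto
  then obtain w0 where w0: "w0 \<in> ?V" "card (?R `` {w0}) = \<delta>" by blast
  \<comment> \<open>Of the \<open>k + 2 - t\<close> vertices available in \<open>D\<close>, one is
    given up for \<open>w0\<close>, whose degree is exactly \<open>\<delta>\<close>; this works
    whether or not \<open>w0\<close> lies in \<open>D\<close>.\<close>
  have "k + 1 - t \<le> card (D - {w0})"
    using D(2) by (cases "w0 \<in> D") (auto simp: card_Diff_singleton)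
  then obtain D0 where D0: "D0 \<subseteq> D - {w0}" "card D0 = k + 1 - t"
    using obtain_subset_with_card_n by metis
  have fD0: "finite D0" and "w0 \<notin> D0"
    using D0(1) finite_subset[of D0 ?V] D(1) fV by auto
  have cD: "card (insert w0 D0) = k + 2 - t"
    using fD0 \<open>w0 \<notin> D0\<close> D0(2) \<open>\<delta> \<le> k\<close> assms(3) by simp
  have "num_cliques s G \<le> (n - (k + 2 - t) choose s) + (\<Sum>w\<in>insert w0 D0. card (?R `` {w}) choose r)"
    using num_cliques_le[OF fV RV, of "insert w0 D0" s] w0(1) D0(1) D(1) assms(1)
    unfolding cD assms(7) r_def by auto
  also have "(\<Sum>w\<in>insert w0 D0. card (?R `` {w}) choose r)
      = (\<delta> choose r) + (\<Sum>w\<in>D0. card (?R `` {w}) choose r)"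
    using fD0 \<open>w0 \<notin> D0\<close> w0(2) by simp
  also have "(\<Sum>w\<in>D0. card (?R `` {w}) choose r) \<le> (k + 1 - t) * (k choose r)"
    using sum_bounded_above[of D0 "\<lambda>w. card (?R `` {w}) choose r" "k choose r"]
      small D0 binomial_right_mono by fastforce
  also have "n - (k + 2 - t) = n + t - 2 - k" using \<open>\<delta> \<le> k\<close> assms(3) by simp
  finally have "num_cliques s G \<le> \<phi> k + (\<delta> choose r)"
    unfolding \<phi>_def by simp
  also have "\<phi> k \<le> max (\<phi> \<delta>) (\<phi> h)"
  proof (rule convex_le_max_ends[OF _ \<open>\<delta> \<le> k\<close> \<open>k \<le> h\<close>])
    fix j assume "\<delta> \<le> j" "j + 2 \<le> h"
    then have "t \<le> Suc j" "j + 2 \<le> n + t - 2"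
      using assms(3) n assms(7) unfolding h_def by linarith+
    then show "2 * \<phi> (Suc j) \<le> \<phi> j + \<phi> (j + 2)"
      unfolding \<phi>_def by (rule clique_bound_convex)
  qed
  \<comment> \<open>At \<open>\<delta>\<close> the extra binomial merges into the coefficient,
    raising it from \<open>\<delta> - t + 1\<close> to \<open>\<delta> - t + 2\<close>; at
    \<open>h\<close> it remains a separate term of \<open>g2\<close>.\<close>
  also have "max (\<phi> \<delta>) (\<phi> h) + (\<delta> choose r) = max (f2 n t \<delta> s) (g2 n t \<delta> s)"
  proof -
    have "t \<le> h" using assms(3,4) unfolding h_def by simp
    have "n + t - 2 - \<delta> = n + t - \<delta> - 2" "n + t - 2 - h = n + t - h - 2"
      "\<delta> - t + 2 = Suc (\<delta> + 1 - t)" "h - t + 1 = h + 1 - t"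
      using assms(3) \<open>t \<le> h\<close> by auto
    then show ?thesis
      unfolding f2_def g2_def \<phi>_def Let_def h_def[symmetric] r_def[symmetric]
      by (simp add: max_def)
  qed
  finally show False using assms(9) by simp
qed

end
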